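(* Every Artinian $T_0$ web space is a $B$-space. More explicitly, if $(X,\tau)$ is a $T_0$ web space whose specialization order $\le_\tau$ is Artinian, then for every $U\in\tau$ and every $x\in U$ there is $k\in K_\tau(X)$ such that $$k\le_\tau x,\qquad x\in{\uparrow}k\subseteq U.$$
   Context: For a $T_0$ space $(X,\tau)$ the specialization order is $x\le_\tau y$ iff $x\in\overline{\{y\}}$; ${\uparrow}$ and ${\downarrow}$ (upward and downward closures of points or subsets) refer to this order. A $T_0$ space $(X,\tau)$ is a web space if for all $U\in\tau$ and $x\in U$ one has ${\uparrow}(U\cap{\downarrow}x)\in\tau$ (equivalently, the lattice of closed subsets of $X$ ordered by inclusion is a complete Heyting algebra). A poset is Artinian if every nonempty subset has a minimal element; a space is called Artinian if its specialization order is. An open core is an open set of the form ${\uparrow}k$; a $B$-space is a space with a base of open cores. $K_\tau(X)=\{k\in X:{\uparrow}k\in\tau\}$. *)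

theory Defs
  imports "HOL-Analysis.Analysis"
begin

text \<open>
  Spaces are topologies in the sense of \<^typ>\<open>'a topology\<close>, with carrier
  \<^term>\<open>topspace X\<close>. The specialization order below relates only points of the carrier,
  since \<^term>\<open>X closure_of {y}\<close> is contained in \<^term>\<open>topspace X\<close>, and is empty
  if \<^term>\<open>y\<close> lies outside \<^term>\<open>topspace X\<close>.
\<close>

definition spec_le :: "'a topology \<Rightarrow> 'a \<Rightarrow> 'a \<Rightarrow> bool" where
  "spec_le X x y \<longleftrightarrow> x \<in> X closure_of {y}"

lemma spec_le_refl: "x \<in> topspace X \<Longrightarrow> spec_le X x x"
  by (simp add: spec_le_def in_closure_of)

lemma spec_le_iff:
  "spec_le X x y \<longleftrightarrow> x \<in> topspace X \<and> (\<forall>U. openin X U \<and> x \<in> U \<longrightarrow> y \<in> U)"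
  by (auto simp: spec_le_def in_closure_of)

lemma spec_le_trans:
  assumes "spec_le X x y" "spec_le X y z"
  shows "spec_le X x z"
  using assms unfolding spec_le_iff by blast

lemma spec_le_antisym:
  assumes "t0_space X" "spec_le X x y" "spec_le X y x"
  shows "x = y"
proof (rule ccontr)
  assume "x \<noteq> y"
  moreover have "x \<in> topspace X" "y \<in> topspace X"
    using assms(2,3) by (simp_all add: spec_le_iff)
  ultimately obtain U where "openin X U" "x \<notin> U \<longleftrightarrow> y \<in> U"
    using assms(1) unfolding t0_space_def by metis
  then show False
    using assms(2,3) unfolding spec_le_iff by metis
qed

lemma spec_le_carrier:
  assumes "spec_le X x y"
  shows "x \<in> topspace X \<and> y \<in> topspace X"
  using assms openin_topspace[of X] unfolding spec_le_iff by metis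

definition up_closure :: "'a topology \<Rightarrow> 'a set \<Rightarrow> 'a set" where
  "up_closure X A = {y. \<exists>a\<in>A. spec_le X a y}"

definition down_closure :: "'a topology \<Rightarrow> 'a set \<Rightarrow> 'a set" where
  "down_closure X A = {y. \<exists>a\<in>A. spec_le X y a}"

text \<open>
  The separation axiom \<^const>\<open>t0_space\<close> is not built into the notions below;
  it is to be assumed separately.
\<close>

definition web_space :: "'a topology \<Rightarrow> bool" where
  "web_space X \<longleftrightarrow>
     (\<forall>U x. openin X U \<and> x \<in> U \<longrightarrow> openin X (up_closure X (U \<inter> down_closure X {x})))"

definition artinian_on :: "'a set \<Rightarrow> ('a \<Rightarrow> 'a \<Rightarrow> bool) \<Rightarrow> bool" where
  "artinian_on P le \<longleftrightarrow>
     (\<forall>S. S \<subseteq> P \<and> S \<noteq> {} \<longrightarrow> (\<exists>m\<in>S. \<forall>y\<in>S. le y m \<longrightarrow> y = m))"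

definition artinian_space :: "'a topology \<Rightarrow> bool" where
  "artinian_space X \<longleftrightarrow> artinian_on (topspace X) (spec_le X)"

definition core_points :: "'a topology \<Rightarrow> 'a set" where
  "core_points X = {k \<in> topspace X. openin X (up_closure X {k})}"

definition open_core :: "'a topology \<Rightarrow> 'a set \<Rightarrow> bool" where
  "open_core X V \<longleftrightarrow> openin X V \<and> (\<exists>k\<in>topspace X. V = up_closure X {k})"

definition B_space :: "'a topology \<Rightarrow> bool" where
  "B_space X \<longleftrightarrow>
     (\<exists>\<B>. (\<forall>V\<in>\<B>. open_core X V) \<and> openin X = arbitrary union_of (\<lambda>V. V \<in> \<B>))"

end

theory Submission
  imports Defs
begin

text \<open>
  If \<open>k\<close> is minimal in \<open>U \<inter> \<down>x\<close>, then \<open>U \<inter> \<down>k = {k}\<close>, so the web condition applied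
  at \<open>k\<close> says that \<open>\<up>k\<close> is open.
\<close>

text \<open>Open sets are upper sets of the specialization order, which is immediate from the
  characterization by neighbourhoods in \<open>spec_le_iff\<close>.\<close>

lemma up_closure_subset_openin:
  assumes "openin X U" "A \<subseteq> U"
  shows "up_closure X A \<subseteq> U"
  using assms unfolding up_closure_def spec_le_iff by blast

lemma web_space_core_point:
  assumes "web_space X" "openin X U" "k \<in> U" "U \<inter> down_closure X {k} = {k}"
  shows "k \<in> core_points X"
proof -
  have "openin X (up_closure X (U \<inter> down_closure X {k}))"
    using assms(1-3) unfolding web_space_def by blast
  \<comment> \<open>\<open>openin_subset\<close> puts \<open>k\<close> in the carrier, the other
    half of being a core point.\<close>
  then show ?thesis
    using assms(3,4) openin_subset[OF assms(2)] by (auto simp: core_points_def)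
qed

text \<open>The point \<open>k\<close> is a minimal element of
  \<open>U \<inter> down_closure X {x}\<close>, a set that is nonempty because it contains
  \<open>x\<close>.\<close>

lemma artinian_minimal_below:
  assumes "artinian_space X" "openin X U" "x \<in> U"
  obtains k where "k \<in> U" "spec_le X k x" "U \<inter> down_closure X {k} = {k}"
proof -
  have U: "U \<subseteq> topspace X"
    using assms(2) by (rule openin_subset)
  have "x \<in> U \<inter> down_closure X {x}"
    using U assms(3) spec_le_refl[of x X] by (auto simp: down_closure_def)
  then have "U \<inter> down_closure X {x} \<subseteq> topspace X \<and> U \<inter> down_closure X {x} \<noteq> {}"
    using U by blast
  then obtain k where k: "k \<in> U \<inter> down_closure X {x}"
    and min: "\<forall>y\<in>U \<inter> down_closure X {x}. spec_le X y k \<longrightarrow> y = k"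
    using assms(1) unfolding artinian_space_def artinian_on_def by meson
  have kx: "k \<in> U" "spec_le X k x"
    using k by (auto simp: down_closure_def)
  have "spec_le X k k"
    using kx(1) U by (blast intro: spec_le_refl)
  \<comment> \<open>By transitivity such a \<open>y\<close> also lies below \<open>x\<close>, hence
    in the set where \<open>k\<close> was chosen minimal.\<close>
  moreover have "y = k" if "y \<in> U" "spec_le X y k" for y
    using that min spec_le_trans[OF that(2) kx(2)] by (simp add: down_closure_def)
  ultimately have "U \<inter> down_closure X {k} = {k}"
    using kx(1) unfolding down_closure_def by blast
  with kx show thesis
    by (rule that)
qed

text \<open>This is the local form of the base property: the up-closure of a minimal point below
  \<open>x\<close> is an open core that contains \<open>x\<close> and stays inside
  \<open>U\<close>.\<close>

lemma artinian_web_space_core_below: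
  assumes "web_space X" "artinian_space X" "openin X U" "x \<in> U"
  shows "\<exists>k\<in>core_points X. spec_le X k x \<and> x \<in> up_closure X {k} \<and> up_closure X {k} \<subseteq> U"
proof -
  obtain k where k: "k \<in> U" "spec_le X k x" "U \<inter> down_closure X {k} = {k}"
    using artinian_minimal_below[OF assms(2-4)] .
  have "k \<in> core_points X"
    using web_space_core_point[OF assms(1,3) k(1,3)] .
  moreover have "x \<in> up_closure X {k}"
    using k(2) by (simp add: up_closure_def)
  moreover have "up_closure X {k} \<subseteq> U"
    using up_closure_subset_openin[OF assms(3)] k(1) by simp
  ultimately show ?thesis
    using k(2) by blast
qed

theorem theorem6p2:
  fixes X :: "'a topology"
  assumes "t0_space X" and "web_space X" and "artinian_space X"
  shows "B_space X \<and>
    (\<forall>U x. openin X U \<and> x \<in> U \<longrightarrow>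
       (\<exists>k\<in>core_points X. spec_le X k x \<and> x \<in> up_closure X {k} \<and> up_closure X {k} \<subseteq> U))"
proof (intro conjI allI impI)
  have "\<exists>V. V \<in> Collect (open_core X) \<and> x \<in> V \<and> V \<subseteq> U" if Ux: "openin X U" "x \<in> U" for U x
  proof -
    obtain k where k: "k \<in> core_points X" "x \<in> up_closure X {k}" "up_closure X {k} \<subseteq> U"
      using artinian_web_space_core_below[OF assms(2,3) Ux] by blast
    from k(1) have "open_core X (up_closure X {k})"
      unfolding core_points_def open_core_def by blast
    with k(2,3) show ?thesis
      by blast
  qed
  moreover have "\<forall>V. V \<in> Collect (open_core X) \<longrightarrow> openin X V"
    by (simp add: open_core_def)
  \<comment> \<open>The base consists of all open cores. The criterion
    \<open>openin_topology_base_unique\<close> asks only that they be open and that one fit between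
    each point and any open set around it.\<close>
  ultimately have "openin X = arbitrary union_of (\<lambda>V. V \<in> Collect (open_core X))"
    by (intro openin_topology_base_unique[THEN iffD2] conjI allI impI) simp_all
  then show "B_space X"
    unfolding B_space_def by (intro exI[of _ "Collect (open_core X)"]) simp
next
  fix U x
  assume "openin X U \<and> x \<in> U"
  then show "\<exists>k\<in>core_points X. spec_le X k x \<and> x \<in> up_closure X {k} \<and> up_closure X {k} \<subseteq> U"
    using artinian_web_space_core_below[OF assms(2,3)] by simp
qed

end
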